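(* Let $x,y\in\mathbb{R}^n$ have positive components and let $m>0$ be a real number. Assume that $\log x\prec_w\log y$. Then $$\sum_{i=1}^n e^{m x_i}\ \le\ \sum_{i=1}^n e^{m y_i}.$$
   Context: For $z\in\mathbb{R}^n$ with positive components, $\log z=(\log z_1,\dots,\log z_n)$, with $\log$ the natural logarithm. For $u\in\mathbb{R}^n$, $u_1^\downarrow\ge\dots\ge u_n^\downarrow$ denote the components of $u$ in descending order. For $u,v\in\mathbb{R}^n$, $u\prec_w v$ ($u$ is weakly majorized by $v$ from below) means $\sum_{i=1}^k u_i^\downarrow\le\sum_{i=1}^k v_i^\downarrow$ for all $k\in\{1,\dots,n\}$. Thus $\log x\prec_w\log y$ means $x_1^\downarrow\cdots x_k^\downarrow\le y_1^\downarrow\cdots y_k^\downarrow$ for all $k\in\{1,\dots,n\}$. *)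

theory Defs
  imports "HOL-Analysis.Analysis" "HOL-Library.Multiset"
begin

definition ln_vec :: "real ^ 'n \<Rightarrow> real ^ 'n" where
  "ln_vec z = (\<chi> i. ln (z $ i))"

text \<open>The components of a vector with multiplicity, in descending order; positions are counted
  from 0, so the largest component is \<open>desc_comps u ! 0\<close>.\<close>

definition desc_comps :: "real ^ 'n \<Rightarrow> real list" where
  "desc_comps u = rev (sorted_list_of_multiset (image_mset (($) u) (mset_set UNIV)))"

definition weakly_majorized :: "real ^ 'n \<Rightarrow> real ^ 'n \<Rightarrow> bool"  (infix "\<prec>\<^sub>w" 50) where
  "u \<prec>\<^sub>w v \<longleftrightarrow>
     (\<forall>k\<in>{1..CARD('n)}. (\<Sum>i<k. desc_comps u ! i) \<le> (\<Sum>i<k. desc_comps v ! i))"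

lemma length_desc_comps: "length (desc_comps (u :: real ^ 'n)) = CARD('n)"
proof -
  have "length (desc_comps u) = size (mset (desc_comps u))"
    by simp
  also have "\<dots> = CARD('n)"
    by (simp add: desc_comps_def del: size_mset)
  finally show ?thesis .
qed

end

theory Submission
  imports Defs
begin

text \<open>This is the Tomic--Weyl inequality for \<open>s \<mapsto> exp (m * exp s)\<close>, which is convex and
  increasing. Comparing with the tangents at the descending components of \<open>ln x\<close> bounds the
  difference of the two sums from below by a combination of the differences of components
  with nonnegative, decreasing weights. This combination is nonnegative by Abel summation.\<close>

text \<open>Abel summation in a form suited to induction: the sum of the \<open>d i\<close> up to
  \<open>k\<close> is nonnegative, so lowering its weight from \<open>c k\<close> to
  \<open>c (Suc k)\<close> can only decrease the product.\<close>

lemma sum_decreasing_weights_ge: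
  fixes c d :: "nat \<Rightarrow> real"
  assumes "\<And>i. Suc i \<le> k \<Longrightarrow> c (Suc i) \<le> c i"
    and "\<And>i. i \<le> k \<Longrightarrow> (\<Sum>j\<le>i. d j) \<ge> 0"
  shows "c k * (\<Sum>i\<le>k. d i) \<le> (\<Sum>i\<le>k. c i * d i)"
  using assms
proof (induction k)
  case 0
  then show ?case by simp
next
  case (Suc k)
  have "c (Suc k) * (\<Sum>i\<le>k. d i) \<le> c k * (\<Sum>i\<le>k. d i)"
    using Suc.prems by (intro mult_right_mono) auto
  also have "\<dots> \<le> (\<Sum>i\<le>k. c i * d i)"
    using Suc by simp
  finally show ?case
    by (simp add: distrib_left)
qed

lemma sum_decreasing_weights_nonneg:
  fixes c d :: "nat \<Rightarrow> real"
  assumes "\<And>i. Suc i < n \<Longrightarrow> c (Suc i) \<le> c i"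
    and "\<And>i. i < n \<Longrightarrow> c i \<ge> 0"
    and "\<And>k. k \<in> {1..n} \<Longrightarrow> (\<Sum>i<k. d i) \<ge> 0"
  shows "(\<Sum>i<n. c i * d i) \<ge> 0"
proof (cases n)
  case (Suc k)
  \<comment> \<open>The assumption counts terms, as weak majorization does; here \<open>i\<close> is
    the last index, hence \<open>Suc i\<close> terms.\<close>
  have partial: "(\<Sum>j\<le>i. d j) \<ge> 0" if "i \<le> k" for i
    using assms(3)[of "Suc i"] that Suc by (simp add: lessThan_Suc_atMost)
  have "0 \<le> c k * (\<Sum>i\<le>k. d i)"
    using assms(2) partial Suc by simp
  also have "\<dots> \<le> (\<Sum>i\<le>k. c i * d i)"
    using assms(1) partial Suc by (intro sum_decreasing_weights_ge) auto
  finally show ?thesis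
    by (simp add: Suc lessThan_Suc_atMost)
qed simp

lemma sum_desc_comps:
  fixes u :: "real ^ 'n" and f :: "real \<Rightarrow> real"
  shows "(\<Sum>i<CARD('n). f (desc_comps u ! i)) = (\<Sum>i\<in>UNIV. f (u $ i))"
proof -
  have "(\<Sum>i<CARD('n). f (desc_comps u ! i)) = sum_list (map f (desc_comps u))"
    by (simp add: sum_list_sum_nth length_desc_comps lessThan_atLeast0)
  also have "\<dots> = sum_mset (image_mset f (mset (desc_comps u)))"
    by (metis mset_map sum_mset_sum_list)
  also have "\<dots> = (\<Sum>i\<in>UNIV. f (u $ i))"
    by (simp add: desc_comps_def sum_unfold_sum_mset image_mset.compositionality comp_def)
  finally show ?thesis .
qed

lemma desc_comps_Suc_le:
  fixes u :: "real ^ 'n"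
  assumes "Suc i < CARD('n)"
  shows "desc_comps u ! Suc i \<le> desc_comps u ! i"
proof -
  have "sorted (rev (desc_comps u))"
    by (simp add: desc_comps_def)
  then show ?thesis
    using assms sorted_rev_nth_mono[of "desc_comps u" i "Suc i"] by (simp add: length_desc_comps)
qed

text \<open>\<open>f'\<close> selects a subgradient at each point, which encodes convexity of
  \<open>f\<close>; its nonnegativity encodes that \<open>f\<close> is increasing.\<close>

lemma weakly_majorized_sum_le:
  fixes u v :: "real ^ 'n" and f f' :: "real \<Rightarrow> real"
  assumes "u \<prec>\<^sub>w v"
    and subgradient: "\<And>s t. f s + f' s * (t - s) \<le> f t"
    and "mono f'" and "\<And>s. f' s \<ge> 0"
  shows "(\<Sum>i\<in>UNIV. f (u $ i)) \<le> (\<Sum>i\<in>UNIV. f (v $ i))"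
proof -
  let ?u = "\<lambda>i. desc_comps u ! i" and ?v = "\<lambda>i. desc_comps v ! i"
  \<comment> \<open>The weights decrease in \<open>i\<close> because \<open>?u\<close> does and
    \<open>f'\<close> is monotone; weak majorization makes the partial sums of
    \<open>?v i - ?u i\<close> nonnegative.\<close>
  have "0 \<le> (\<Sum>i<CARD('n). f' (?u i) * (?v i - ?u i))"
    using assms by (intro sum_decreasing_weights_nonneg)
      (auto simp: weakly_majorized_def sum_subtractf intro: monoD desc_comps_Suc_le)
  also have "\<dots> \<le> (\<Sum>i<CARD('n). f (?v i) - f (?u i))"
    using subgradient by (intro sum_mono) (simp add: le_diff_eq add.commute)
  finally show ?thesis
    by (simp add: sum_subtractf sum_desc_comps)
qed

lemma exp_tangent_le: "exp s * (1 + (t - s)) \<le> exp (t :: real)"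
proof -
  have "exp s * (1 + (t - s)) \<le> exp s * exp (t - s)"
    by (intro mult_left_mono exp_ge_add_one_self) simp
  then show ?thesis
    by (simp flip: exp_add)
qed

text \<open>The tangent bound for \<open>exp\<close> is used twice: inside at \<open>s\<close>,
  scaled by \<open>m\<close>, then outside at \<open>m * exp s\<close>. The slope is the chain-rule
  derivative.\<close>

lemma exp_exp_tangent_le:
  fixes m s t :: real
  assumes "m \<ge> 0"
  shows "exp (m * exp s) + exp (m * exp s) * (m * exp s) * (t - s) \<le> exp (m * exp t)"
proof -
  have "m * exp s * (t - s) \<le> m * exp t - m * exp s"
    using mult_left_mono[OF exp_tangent_le[of s t] assms] by (simp add: algebra_simps)
  then have "exp (m * exp s) * (1 + m * exp s * (t - s))
      \<le> exp (m * exp s) * (1 + (m * exp t - m * exp s))"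
    by (intro mult_left_mono add_left_mono) auto
  also have "\<dots> \<le> exp (m * exp t)"
    by (rule exp_tangent_le)
  finally show ?thesis
    by (simp add: algebra_simps)
qed

theorem proposition4p1:
  fixes x y :: "real ^ 'n" and m :: real
  assumes "\<And>i. x $ i > 0"
    and "\<And>i. y $ i > 0"
    and "m > 0"
    and "ln_vec x \<prec>\<^sub>w ln_vec y"
  shows "(\<Sum>i\<in>UNIV. exp (m * x $ i)) \<le> (\<Sum>i\<in>UNIV. exp (m * y $ i))"
proof -
  have "mono (\<lambda>s. exp (m * exp s) * (m * exp s))"
    using \<open>m > 0\<close> by (intro monoI mult_mono) auto
  then have "(\<Sum>i\<in>UNIV. exp (m * exp (ln_vec x $ i))) \<le> (\<Sum>i\<in>UNIV. exp (m * exp (ln_vec y $ i)))"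
    using \<open>m > 0\<close> exp_exp_tangent_le[of m] by (intro weakly_majorized_sum_le[OF assms(4)]) auto
  \<comment> \<open>Positive components give \<open>exp (ln (x $ i)) = x $ i\<close>, and likewise
    for \<open>y\<close>.\<close>
  then show ?thesis
    using assms(1,2) by (simp add: ln_vec_def)
qed

end
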